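(* Let $D=(d_n)$ be a fixed sequence of natural numbers with $d_n>1$, $A_{d_n}=\{0,1,\dots,d_n-1\}$, $N_B\subseteq\mathbb{N}$ a fixed subset, and $\delta_n=2$ if $n\notin N_B$, $\delta_n=1$ if $n\in N_B$. Let $$x'_0=-\sum_{n\in N_B}\frac{d_n-1}{d_1d_2\cdots d_n},\qquad x''_0=\sum_{n\notin N_B}\frac{d_n-1}{d_1d_2\cdots d_n}.$$ Then for every $x\in[x'_0;x''_0]$ there exists a sequence $(\varepsilon_n)$ with $\varepsilon_n\in A_{d_n}$ such that $$x=\sum_{n=1}^\infty\frac{(-1)^{\delta_n}\varepsilon_n}{d_1d_2\cdots d_n}.$$
   Context: Such a representation is called a quasi-nega-$D$-representation (alternating $N_B$-Cantor series expansion) of $x$, denoted $x=\Delta^{(\pm D,B)}_{\varepsilon_1\varepsilon_2\dots\varepsilon_n\dots}$. *)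

theory Defs
  imports "HOL-Analysis.Analysis"
begin

text \<open>
  Sequences are indexed by the positive integers: a sequence is a function on \<open>nat\<close>
  whose value at \<open>0\<close> is never used, and \<open>N\<^sub>B\<close> is a subset of \<open>{1..}\<close>.
\<close>

definition cantor_digits :: "(nat \<Rightarrow> nat) \<Rightarrow> nat \<Rightarrow> nat set" where
  "cantor_digits d n = {0..d n - 1}"

definition cantor_denom :: "(nat \<Rightarrow> nat) \<Rightarrow> nat \<Rightarrow> real" where
  "cantor_denom d n = (\<Prod>k=1..n. real (d k))"

definition sign_exp :: "nat set \<Rightarrow> nat \<Rightarrow> nat" where
  "sign_exp NB n = (if n \<in> NB then 1 else 2)"

text \<open>
  The series of the terms \<open>(d n - 1) / (d 1 \<cdots> d n)\<close> telescopes, so for \<open>d n > 1\<close> both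
  unordered sums below converge absolutely, whatever the index set.
\<close>

definition lower_end :: "(nat \<Rightarrow> nat) \<Rightarrow> nat set \<Rightarrow> real" where
  "lower_end d NB = - (\<Sum>\<^sub>\<infinity>n\<in>NB. (real (d n) - 1) / cantor_denom d n)"

definition upper_end :: "(nat \<Rightarrow> nat) \<Rightarrow> nat set \<Rightarrow> real" where
  "upper_end d NB = (\<Sum>\<^sub>\<infinity>n\<in>{1..} - NB. (real (d n) - 1) / cantor_denom d n)"

end

theory Submission
  imports Defs
begin

text \<open>
  Since \<open>(d n - 1) / (d 1 \<cdots> d n)\<close> sums to \<open>1\<close>, translating by \<open>- lower_end d NB\<close> maps the
  interval onto \<open>[0, 1]\<close>, where the greedy algorithm gives an ordinary Cantor expansion with
  digits \<open>c n\<close>. Replacing \<open>c n\<close> by \<open>d n - 1 - c n\<close> for \<open>n \<in> NB\<close> undoes the translation and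
  flips precisely the signs at the indices in \<open>NB\<close>.
\<close>

lemma cantor_denom_0 [simp]: "cantor_denom d 0 = 1"
  by (simp add: cantor_denom_def)

lemma cantor_denom_Suc [simp]: "cantor_denom d (Suc n) = cantor_denom d n * real (d (Suc n))"
  by (simp add: cantor_denom_def)

lemma cantor_denom_ge_power2:
  assumes "\<And>n. n \<ge> 1 \<Longrightarrow> d n > 1"
  shows "2 ^ n \<le> cantor_denom d n"
proof (induction n)
  case (Suc n)
  have "2 \<le> real (d (Suc n))"
    using assms[of "Suc n"] by simp
  with Suc have "2 ^ n * 2 \<le> cantor_denom d n * real (d (Suc n))"
    by (intro mult_mono) (auto intro: order_trans[OF _ Suc])
  then show ?case by simp
qed simp

lemma cantor_denom_pos:
  assumes "\<And>n. n \<ge> 1 \<Longrightarrow> d n > 1"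
  shows "cantor_denom d n > 0"
  using cantor_denom_ge_power2[of d n] assms
  by (meson less_le_trans zero_less_numeral zero_less_power)

lemma bounded_over_cantor_denom_tendsto_0:
  assumes "\<And>n. n \<ge> 1 \<Longrightarrow> d n > 1" and "\<And>n. r n \<in> {0..1::real}"
  shows "(\<lambda>n. r n / cantor_denom d n) \<longlonglongrightarrow> 0"
proof (rule Lim_null_comparison)
  show "\<forall>\<^sub>F n in sequentially. norm (r n / cantor_denom d n) \<le> (1/2) ^ n"
  proof (intro always_eventually allI)
    fix n
    have "r n / cantor_denom d n \<le> 1 / 2 ^ n"
      using assms(2)[of n] cantor_denom_ge_power2[of d n] assms(1) by (intro frac_le) auto
    then show "norm (r n / cantor_denom d n) \<le> (1/2) ^ n"
      using assms(2)[of n] cantor_denom_pos[of d n] assms(1) by (simp add: power_one_over)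
  qed
qed (simp add: LIMSEQ_realpow_zero)

text \<open>Dividing the recursion by \<open>cantor_denom d (Suc n)\<close> turns each term into a
  difference of consecutive values of \<open>r n / cantor_denom d n\<close>. The series telescopes,
  and bounded remainders over denominators of size at least 2^n tend to 0.\<close>

lemma cantor_series_of_remainders:
  fixes c :: "nat \<Rightarrow> nat" and r :: "nat \<Rightarrow> real"
  assumes d: "\<And>n. n \<ge> 1 \<Longrightarrow> d n > 1" and r: "\<And>n. r n \<in> {0..1}"
    and step: "\<And>n. r (Suc n) = real (d (Suc n)) * r n - real (c (Suc n))"
  shows "(\<lambda>n. real (c (Suc n)) / cantor_denom d (Suc n)) sums r 0"
proof -
  have "real (c (Suc n)) / cantor_denom d (Suc n)
      = r n / cantor_denom d n - r (Suc n) / cantor_denom d (Suc n)" for n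
  proof -
    have "cantor_denom d n > 0"
      using d by (rule cantor_denom_pos)
    moreover have "real (d (Suc n)) > 0"
      using d[of "Suc n"] by simp
    ultimately show ?thesis
      by (simp add: step field_simps)
  qed
  then show ?thesis
    using telescope_sums'[OF bounded_over_cantor_denom_tendsto_0[of d r]] d r by simp
qed

text \<open>The remainder 1 is a fixed point when every digit is maximal, since
  \<open>d n * 1 - (d n - 1) = 1\<close>.\<close>

lemma cantor_series_max_digits:
  assumes d: "\<And>n. n \<ge> 1 \<Longrightarrow> d n > 1"
  shows "(\<lambda>n. (real (d (Suc n)) - 1) / cantor_denom d (Suc n)) sums 1"
proof -
  have "real (d (Suc n) - 1) = real (d (Suc n)) - 1" for n
    using d[of "Suc n"] by simp
  then show ?thesis
    using cantor_series_of_remainders[of d "\<lambda>_. 1" "\<lambda>n. d n - 1"] d by simp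
qed

lemma cantor_series_exists:
  assumes d: "\<And>n. n \<ge> 1 \<Longrightarrow> d n > 1" and y: "y \<in> {0..1::real}"
  shows "\<exists>c :: nat \<Rightarrow> nat. (\<forall>n\<ge>1. c n \<in> cantor_digits d n) \<and>
    (\<lambda>n. real (c (Suc n)) / cantor_denom d (Suc n)) sums y"
proof -
  \<comment> \<open>The cap \<open>d n - 1\<close> keeps the digit admissible when the remainder is \<open>1\<close>.\<close>
  define dig where "dig n t = min (nat \<lfloor>real (d n) * t\<rfloor>) (d n - 1)" for n and t :: real
  define r where "r = rec_nat y (\<lambda>n t. real (d (Suc n)) * t - real (dig (Suc n) t))"
  \<comment> \<open>The shift reflects that digit \<open>n\<close> is read off the remainder left by
    the first \<open>n - 1\<close> digits.\<close>
  define c where "c n = dig n (r (n - 1))" for n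
  have r0: "r 0 = y" and rS: "r (Suc n) = real (d (Suc n)) * r n - real (c (Suc n))" for n
    by (simp_all add: r_def c_def)
  \<comment> \<open>Without the cap the new remainder is the fractional part of
    \<open>d n * t\<close>. The cap takes effect only at \<open>t = 1\<close>, where it leaves the
    remainder 1; hence the closed interval as invariant.\<close>
  have "real (d n) * t - real (dig n t) \<in> {0..1}" if "n \<ge> 1" "t \<in> {0..1}" for n t
  proof -
    have "0 \<le> real (d n) * t" "real (d n) * t \<le> real (d n)"
      using that by (auto intro: mult_left_le)
    moreover have "real (d n - 1) = real (d n) - 1"
      using d[OF that(1)] by simp
    ultimately have "real (dig n t) = min (real_of_int \<lfloor>real (d n) * t\<rfloor>) (real (d n) - 1)"
      unfolding dig_def of_nat_min by simp
    then show ?thesis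
      using \<open>real (d n) * t \<le> real (d n)\<close> floor_correct[of "real (d n) * t"]
      unfolding min_def atLeastAtMost_iff of_int_add of_int_1 by (simp split: if_splits; linarith)
  qed
  then have r: "r n \<in> {0..1}" for n
  proof (induction n)
    case (Suc n)
    then show ?case by (simp add: rS c_def)
  qed (use y r0 in simp)
  have "(\<lambda>n. real (c (Suc n)) / cantor_denom d (Suc n)) sums r 0"
    using d r rS by (rule cantor_series_of_remainders)
  then show ?thesis
    by (intro exI[of _ c]) (simp add: r0 c_def dig_def cantor_digits_def)
qed

text \<open>Padding with zeros off \<open>A\<close> turns the unordered sums in the interval ends
  into series over a common index range, which can be combined termwise. Nonnegativity makes the
  convergence absolute, as unordered summation requires.\<close>

lemma sums_infsum_Suc:
  fixes f :: "nat \<Rightarrow> real"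
  assumes "A \<subseteq> {1..}" and nonneg: "\<And>n. f (Suc n) \<ge> 0" and sm: "summable (\<lambda>n. f (Suc n))"
  shows "(\<lambda>n. if Suc n \<in> A then f (Suc n) else 0) sums infsum f A"
proof -
  let ?g = "\<lambda>n. if Suc n \<in> A then f (Suc n) else 0"
  \<comment> \<open>As \<open>A\<close> omits 0, reindexing along \<open>Suc\<close> loses no
    element.\<close>
  have "A = Suc ` (Suc -` A)"
    using assms(1)
    by (auto simp: image_iff) (metis Suc_pred' atLeast_iff less_eq_Suc_le One_nat_def subsetD)
  then have "infsum f A = infsum (f \<circ> Suc) (Suc -` A)"
    by (metis infsum_reindex inj_Suc)
  also have "\<dots> = infsum ?g UNIV"
    by (rule infsum_cong_neutral) auto
  finally have eq: "infsum f A = infsum ?g UNIV" .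
  have "summable ?g"
    by (rule summable_comparison_test'[OF sm, of 0]) (use nonneg in auto)
  then have "?g summable_on UNIV"
    using nonneg by (intro norm_summable_imp_summable_on) simp
  then show ?thesis
    unfolding eq by (intro has_sum_imp_sums has_sum_infsum)
qed

theorem theorem3:
  fixes d :: "nat \<Rightarrow> nat" and NB :: "nat set" and x :: real
  assumes "\<And>n. n \<ge> 1 \<Longrightarrow> d n > 1"
    and "NB \<subseteq> {1..}"
    and "x \<in> {lower_end d NB..upper_end d NB}"
  shows "\<exists>\<epsilon> :: nat \<Rightarrow> nat. (\<forall>n\<ge>1. \<epsilon> n \<in> cantor_digits d n) \<and>
    (\<lambda>n. (-1) ^ sign_exp NB (Suc n) * real (\<epsilon> (Suc n)) / cantor_denom d (Suc n)) sums x"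
proof -
  note d = assms(1)
  let ?a = "\<lambda>n. (real (d n) - 1) / cantor_denom d n"
  have nonneg: "?a (Suc n) \<ge> 0" for n
    using d[of "Suc n"] cantor_denom_pos[OF d, where n = "Suc n"]
    by (intro divide_nonneg_pos) simp_all
  have total: "(\<lambda>n. ?a (Suc n)) sums 1"
    using cantor_series_max_digits d by blast
  have L: "(\<lambda>n. if Suc n \<in> NB then ?a (Suc n) else 0) sums - lower_end d NB"
    unfolding lower_end_def minus_minus
    using assms(2) nonneg sums_summable[OF total] by (rule sums_infsum_Suc)
  have U: "(\<lambda>n. if Suc n \<in> {1..} - NB then ?a (Suc n) else 0) sums upper_end d NB"
    unfolding upper_end_def using Diff_subset nonneg sums_summable[OF total]
    by (rule sums_infsum_Suc)
  \<comment> \<open>The two padded series have complementary supports, so the interval has length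
    exactly 1.\<close>
  have "(\<lambda>n. ?a (Suc n)) sums (- lower_end d NB + upper_end d NB)"
    by (rule sums_cong[THEN iffD1, OF _ sums_add[OF L U]]) auto
  with total have "- lower_end d NB + upper_end d NB = 1"
    by (rule sums_unique2[symmetric])
  with assms(3) have "x - lower_end d NB \<in> {0..1}"
    by auto
  with d have "\<exists>c :: nat \<Rightarrow> nat. (\<forall>n\<ge>1. c n \<in> cantor_digits d n) \<and>
      (\<lambda>n. real (c (Suc n)) / cantor_denom d (Suc n)) sums (x - lower_end d NB)"
    by (rule cantor_series_exists)
  then obtain c :: "nat \<Rightarrow> nat" where c: "\<forall>n\<ge>1. c n \<le> d n - 1"
    and cs: "(\<lambda>n. real (c (Suc n)) / cantor_denom d (Suc n)) sums (x - lower_end d NB)"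
    by (auto simp: cantor_digits_def)
  define \<epsilon> where "\<epsilon> n = (if n \<in> NB then d n - 1 - c n else c n)" for n
  have "(-1) ^ sign_exp NB (Suc n) * real (\<epsilon> (Suc n)) / cantor_denom d (Suc n)
      = real (c (Suc n)) / cantor_denom d (Suc n) - (if Suc n \<in> NB then ?a (Suc n) else 0)" for n
  proof -
    \<comment> \<open>The digit bound on \<open>c\<close> keeps the natural-number subtraction from
      truncating.\<close>
    have "real (d (Suc n) - 1 - c (Suc n)) = real (d (Suc n)) - 1 - real (c (Suc n))"
      using c[rule_format, of "Suc n"] d[of "Suc n"] by (simp add: of_nat_diff)
    then show ?thesis
      by (simp add: \<epsilon>_def sign_exp_def diff_divide_distrib del: cantor_denom_Suc)
  qed
  \<comment> \<open>The series \<open>L\<close> has sum \<open>- lower_end d NB\<close>, so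
    subtracting it from \<open>cs\<close> cancels the translation.\<close>
  then have "(\<lambda>n. (-1) ^ sign_exp NB (Suc n) * real (\<epsilon> (Suc n)) / cantor_denom d (Suc n)) sums x"
    using sums_diff[OF cs L] by simp
  moreover have "\<forall>n\<ge>1. \<epsilon> n \<in> cantor_digits d n"
    using c by (auto simp: \<epsilon>_def cantor_digits_def)
  ultimately show ?thesis by blast
qed

end
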